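(* Let $W=(W_1,\dots,W_n)$ be a vector of real-valued random variables and let $\mathcal G$ be a collection of bijections $g:[n]\to[n]$ such that $$gW\stackrel d=W\quad\text{for all } g\in\mathcal G .$$ Suppose that for some $i\in\{1,\dots,n\}$ there exists $\mathcal G_0=\{g_1,\dots,g_n\}\subseteq\mathcal G$ such that $g_j(i)=j$ for each $j\in[n]$. Then, for any $i\in\{1,\dots,n\}$ and any $t\in[0,1]$, $$P\left(\frac1n\sum_{k=1}^n\mathbf 1(W_k\ge W_i)\le t\right)\le t.$$
   Context: $[n]=\{1,\dots,n\}$, and for a bijection $g:[n]\to[n]$, $gW=(W_{g(1)},\dots,W_{g(n)})$. *)

theory Defs
  imports "HOL-Probability.Probability"
begin

text \<open>
  Vectors indexed by \<open>[n]\<close> are functions on \<open>{1..n}\<close>, set to \<open>undefined\<close> elsewhere so that they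
  are points of the product space \<open>PiM {1..n} (\<lambda>_. borel)\<close>.
\<close>

definition rand_vec :: "nat \<Rightarrow> (nat \<Rightarrow> 'a \<Rightarrow> real) \<Rightarrow> 'a \<Rightarrow> nat \<Rightarrow> real" where
  "rand_vec n W \<omega> = (\<lambda>k\<in>{1..n}. W k \<omega>)"

definition perm_vars :: "(nat \<Rightarrow> nat) \<Rightarrow> (nat \<Rightarrow> 'a \<Rightarrow> real) \<Rightarrow> nat \<Rightarrow> 'a \<Rightarrow> real" where
  "perm_vars g W = (\<lambda>k. W (g k))"

definition eq_joint_dist ::
  "'a measure \<Rightarrow> nat \<Rightarrow> (nat \<Rightarrow> 'a \<Rightarrow> real) \<Rightarrow> (nat \<Rightarrow> 'a \<Rightarrow> real) \<Rightarrow> bool" where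
  "eq_joint_dist M n V W \<longleftrightarrow>
     distr M (\<Pi>\<^sub>M k\<in>{1..n}. borel) (rand_vec n V) =
     distr M (\<Pi>\<^sub>M k\<in>{1..n}. borel) (rand_vec n W)"

end

theory Submission
  imports Defs
begin

text \<open>
  Exchangeability under \<open>g\<^sub>j\<close> moves the coordinate \<open>i\<^sub>0\<close> to \<open>j\<close>, so the probability that the \<open>j\<close>-th
  normalised rank is at most \<open>t\<close> does not depend on \<open>j\<close>. Pointwise, at most \<open>t n\<close> indices have
  normalised rank at most \<open>t\<close>; taking expectations bounds \<open>n\<close> times the common probability by \<open>t n\<close>.
\<close>

text \<open>The vector is an argument free of randomness, so one function applies both to a sample
  \<open>\<lambda>k. W k \<omega>\<close> and to a point of the product space that carries the joint
  law.\<close>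

definition rank_frac :: "nat \<Rightarrow> (nat \<Rightarrow> real) \<Rightarrow> nat \<Rightarrow> real" where
  "rank_frac n x j = (1 / real n) * (\<Sum>k=1..n. of_bool (x k \<ge> x j))"

lemma rank_frac_eq_card: "rank_frac n x j = real (card {k\<in>{1..n}. x k \<ge> x j}) / real n"
  by (simp add: rank_frac_def sum_of_bool_eq Int_def)

lemma rank_frac_rand_vec:
  assumes "j \<in> {1..n}"
  shows "rank_frac n (rand_vec n W \<omega>) j = rank_frac n (\<lambda>k. W k \<omega>) j"
  using assms unfolding rank_frac_def rand_vec_def by simp

text \<open>Relabelling by a bijection leaves the multiset of compared values unchanged; only the
  reference value moves, from \<open>x j\<close> to \<open>x (g j)\<close>.\<close>

lemma rank_frac_perm:
  assumes "bij_betw g {1..n} {1..n}"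
  shows "rank_frac n (\<lambda>k. x (g k)) j = rank_frac n x (g j)"
  unfolding rank_frac_def
  using sum.reindex_bij_betw[OF assms, of "\<lambda>k. of_bool (x k \<ge> x (g j)) :: real"] by simp

text \<open>Take the index with the smallest value among those counted, ties broken arbitrarily.
  Every counted index has a value at least as large, so it enters the rank of that one index, and
  this rank is at most t * n by the choice of the index.\<close>

lemma card_rank_frac_le:
  assumes "n > 0" and "t \<ge> 0"
  shows "real (card {j\<in>{1..n}. rank_frac n x j \<le> t}) \<le> t * real n"
proof -
  define S where "S = {j\<in>{1..n}. rank_frac n x j \<le> t}"
  have "finite S" by (simp add: S_def)
  have "real (card S) \<le> t * real n"
  proof (cases "S = {}")
    \<comment> \<open>With nothing counted, the bound is just t \<ge> 0.\<close>
    case True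
    with assms show ?thesis by simp
  next
    case False
    with \<open>finite S\<close> obtain j where j: "j \<in> S" "\<And>k. k \<in> S \<Longrightarrow> x j \<le> x k"
      using ex_min_if_finite[of "x ` S"] by (force simp: not_less)
    have "S \<subseteq> {k\<in>{1..n}. x k \<ge> x j}"
      using j(2) by (auto simp: S_def)
    then have "card S \<le> card {k\<in>{1..n}. x k \<ge> x j}"
      by (intro card_mono) auto
    moreover have "real (card {k\<in>{1..n}. x k \<ge> x j}) \<le> t * real n"
      using j(1) assms(1) by (simp add: S_def rank_frac_eq_card divide_le_eq)
    ultimately show ?thesis by simp
  qed
  then show ?thesis by (simp add: S_def)
qed

lemma measurable_rank_frac:
  assumes "\<And>k. k \<in> {1..n} \<Longrightarrow> (\<lambda>\<omega>. X \<omega> k) \<in> borel_measurable M" and "j \<in> {1..n}"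
  shows "(\<lambda>\<omega>. rank_frac n (X \<omega>) j) \<in> borel_measurable M"
proof -
  have "(\<lambda>\<omega>. of_bool (X \<omega> k \<ge> X \<omega> j) :: real) \<in> borel_measurable M" if "k \<in> {1..n}" for k
  proof -
    note [measurable] = assms(1)[OF that] assms(1)[OF assms(2)]
    show ?thesis by measurable
  qed
  then show ?thesis
    unfolding rank_frac_def by (intro borel_measurable_times borel_measurable_sum) auto
qed

text \<open>Writes the probability as a functional of the joint law alone, which is the form in
  which \<open>eq_joint_dist\<close> can be applied. The restriction in \<open>rand_vec\<close> is
  harmless because ranks read only coordinates in \<open>{1..n}\<close>.\<close>

lemma measure_rank_frac_distr:
  assumes W: "\<And>k. k \<in> {1..n} \<Longrightarrow> W k \<in> borel_measurable M" and j: "j \<in> {1..n}"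
  shows "measure M {\<omega>\<in>space M. rank_frac n (\<lambda>k. W k \<omega>) j \<le> t} =
    measure (distr M (\<Pi>\<^sub>M k\<in>{1..n}. borel) (rand_vec n W))
      {x\<in>space (\<Pi>\<^sub>M k\<in>{1..n}. borel). rank_frac n x j \<le> t}"
proof -
  let ?P = "\<Pi>\<^sub>M k\<in>{1..n}. borel :: real measure"
  have V: "rand_vec n W \<in> measurable M ?P"
    unfolding rand_vec_def using W by (intro measurable_restrict)
  have [measurable]: "(\<lambda>x. rank_frac n x j) \<in> borel_measurable ?P"
    using j by (intro measurable_rank_frac measurable_component_singleton) auto
  have "{x\<in>space ?P. rank_frac n x j \<le> t} \<in> sets ?P"
    by measurable
  with V have "measure (distr M ?P (rand_vec n W)) {x\<in>space ?P. rank_frac n x j \<le> t} =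
      measure M (rand_vec n W -` {x\<in>space ?P. rank_frac n x j \<le> t} \<inter> space M)"
    by (rule measure_distr)
  also have "rand_vec n W -` {x\<in>space ?P. rank_frac n x j \<le> t} \<inter> space M =
      {\<omega>\<in>space M. rank_frac n (\<lambda>k. W k \<omega>) j \<le> t}"
    using measurable_space[OF V] by (auto simp: rank_frac_rand_vec[OF j])
  finally show ?thesis by simp
qed

text \<open>The rank at \<open>g j\<close> in W is the rank at j in the permuted vector, which has
  the same law as W.\<close>

lemma measure_rank_frac_perm:
  assumes W: "\<And>k. k \<in> {1..n} \<Longrightarrow> W k \<in> borel_measurable M"
    and g: "bij_betw g {1..n} {1..n}"
    and eq: "eq_joint_dist M n (perm_vars g W) W"
    and j: "j \<in> {1..n}"
  shows "measure M {\<omega>\<in>space M. rank_frac n (\<lambda>k. W k \<omega>) (g j) \<le> t} =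
    measure M {\<omega>\<in>space M. rank_frac n (\<lambda>k. W k \<omega>) j \<le> t}"
proof -
  have gW: "perm_vars g W k \<in> borel_measurable M" if "k \<in> {1..n}" for k
    using W bij_betwE[OF g] that by (auto simp: perm_vars_def)
  have "rank_frac n (\<lambda>k. W k \<omega>) (g j) = rank_frac n (\<lambda>k. perm_vars g W k \<omega>) j" for \<omega>
    using rank_frac_perm[OF g, of "\<lambda>k. W k \<omega>"] by (simp add: perm_vars_def)
  then show ?thesis
    using eq measure_rank_frac_distr[OF W j] measure_rank_frac_distr[OF gW j]
    by (simp add: eq_joint_dist_def)
qed

text \<open>By linearity the left side is the expected number of indices with rank at most t, and
  \<open>card_rank_frac_le\<close> bounds that number at every sample point.\<close>

lemma (in prob_space) sum_prob_rank_frac_le: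
  assumes W: "\<And>k. k \<in> {1..n} \<Longrightarrow> W k \<in> borel_measurable M"
    and n: "n > 0" and t: "t \<ge> 0"
  shows "(\<Sum>j=1..n. prob {\<omega>\<in>space M. rank_frac n (\<lambda>k. W k \<omega>) j \<le> t}) \<le> t * real n"
proof -
  define A where "A j = {\<omega>\<in>space M. rank_frac n (\<lambda>k. W k \<omega>) j \<le> t}" for j
  have A: "A j \<in> events" if "j \<in> {1..n}" for j
  proof -
    have [measurable]: "(\<lambda>\<omega>. rank_frac n (\<lambda>k. W k \<omega>) j) \<in> borel_measurable M"
      using W that by (intro measurable_rank_frac)
    show ?thesis unfolding A_def by measurable
  qed
  have int: "integrable M (indicator (A j) :: _ \<Rightarrow> real)" if "j \<in> {1..n}" for j
    using A[OF that] by (simp add: integrable_real_indicator emeasure_eq_measure)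
  have "(\<Sum>j=1..n. prob (A j)) = (\<Sum>j=1..n. expectation (indicator (A j)))"
    using A by (intro sum.cong) auto
  also have "\<dots> = expectation (\<lambda>\<omega>. \<Sum>j=1..n. indicator (A j) \<omega>)"
    using int by (simp add: Bochner_Integration.integral_sum)
  also have "\<dots> \<le> t * real n"
  proof (rule integral_le_const)
    show "integrable M (\<lambda>\<omega>. \<Sum>j=1..n. indicator (A j) \<omega> :: real)"
      using int by (intro Bochner_Integration.integrable_sum) auto
    have "(\<Sum>j=1..n. indicator (A j) \<omega> :: real) \<le> t * real n" if "\<omega> \<in> space M" for \<omega>
    proof -
      have "(\<Sum>j=1..n. indicator (A j) \<omega> :: real) =
          real (card {j\<in>{1..n}. rank_frac n (\<lambda>k. W k \<omega>) j \<le> t})"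
        using that by (simp add: A_def indicator_def sum_of_bool_eq Int_def)
      with card_rank_frac_le[OF n t] show ?thesis by simp
    qed
    then show "AE \<omega> in M. (\<Sum>j=1..n. indicator (A j) \<omega> :: real) \<le> t * real n"
      by simp
  qed
  finally show ?thesis by (simp add: A_def)
qed

theorem proposition5p1:
  fixes M :: "'a measure"
    and n :: nat
    and W :: "nat \<Rightarrow> 'a \<Rightarrow> real"
    and G :: "(nat \<Rightarrow> nat) set"
    and i :: nat
    and t :: real
  assumes "prob_space M"
    and "\<And>k. k \<in> {1..n} \<Longrightarrow> W k \<in> borel_measurable M"
    and "\<And>g. g \<in> G \<Longrightarrow> bij_betw g {1..n} {1..n}"
    and "\<And>g. g \<in> G \<Longrightarrow> eq_joint_dist M n (perm_vars g W) W"
    and "\<exists>i\<^sub>0\<in>{1..n}. \<exists>G\<^sub>0\<subseteq>G. \<exists>gs :: nat \<Rightarrow> nat \<Rightarrow> nat.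
           G\<^sub>0 = gs ` {1..n} \<and> (\<forall>j\<in>{1..n}. gs j i\<^sub>0 = j)"
    and "i \<in> {1..n}"
    and "t \<in> {0..1}"
  shows "measure M {\<omega> \<in> space M.
           (1 / real n) * (\<Sum>k=1..n. of_bool (W k \<omega> \<ge> W i \<omega>)) \<le> t} \<le> t"
proof -
  interpret prob_space M by fact
  define p where "p j = prob {\<omega>\<in>space M. rank_frac n (\<lambda>k. W k \<omega>) j \<le> t}" for j
  from assms(5) obtain i\<^sub>0 and gs :: "nat \<Rightarrow> nat \<Rightarrow> nat" where i\<^sub>0: "i\<^sub>0 \<in> {1..n}"
    and gs: "gs ` {1..n} \<subseteq> G" "\<And>j. j \<in> {1..n} \<Longrightarrow> gs j i\<^sub>0 = j"
    by blast
  \<comment> \<open>Every index is compared with the base point of the family \<open>gs\<close>;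
    hence the conclusion holds for any i, not only for that base point.\<close>
  have p: "p j = p i\<^sub>0" if j: "j \<in> {1..n}" for j
  proof -
    have "gs j \<in> G" using gs(1) j by blast
    then have "p (gs j i\<^sub>0) = p i\<^sub>0"
      unfolding p_def using assms(2-4) i\<^sub>0 by (intro measure_rank_frac_perm) auto
    with gs(2)[OF j] show ?thesis by simp
  qed
  have n: "n > 0" using i\<^sub>0 by simp
  \<comment> \<open>All n summands equal the common value, which is also \<open>p i\<close>.\<close>
  have "real n * p i = (\<Sum>j=1..n. p j)"
    using p assms(6) by simp
  also have "\<dots> \<le> t * real n"
    unfolding p_def using assms(2,7) n by (intro sum_prob_rank_frac_le) auto
  finally have "p i \<le> t" using n by (simp add: mult.commute)
  then show ?thesis by (simp add: p_def rank_frac_def)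
qed

end
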